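(* Let $m\ge 2$, $n\ge 1$, let $\mathcal{A}\in\mathbb{R}_{+}^{[m,n]}$ be a nonnegative tensor and let $a,b\in\mathbb{R}_{++}^n$. Let $\mathcal{E}\in\mathbb{R}_{++}^{[m,n]}$ be the tensor with entries $E_{i_1i_2\ldots i_m}=a_{i_1}^{m-1}b_{i_2}\cdots b_{i_m}$, and for $t\in[0,1]$ let $$H(\lambda,x,t)=\begin{pmatrix}(t\mathcal{A}+(1-t)\mathcal{E})x^{m-1}-\lambda x^{[m-1]}\\ x^Tx-1\end{pmatrix}.$$ Starting from the Perron pair $(\lambda_0,x_0)=\big((a^Tb)^{m-1},\,a/\|a\|\big)$ of $\mathcal{E}$, let $t\mapsto(\lambda(t),x(t))$, $t\in[0,1)$, be the solution curve of $H(\lambda,x,t)=0$ in $\mathbb{R}_{++}\times\mathbb{R}_{++}^n\times[0,1)$; that is, $(\lambda(0),x(0))=(\lambda_0,x_0)$ and, for every $t\in[0,1)$, $(\lambda(t),x(t))\in\mathbb{R}_{++}\times\mathbb{R}_{++}^n$ and $H(\lambda(t),x(t),t)=0$. Then each limit point of $(\lambda(t),x(t))$ as $t\to1^-$ is a nonnegative eigenpair of $\mathcal{A}$. If furthermore $\mathcal{A}$ is irreducible, then $$\lim_{t\to 1^-}(\lambda(t),x(t))=(\lambda_*,x_* ),$$ where $(\lambda_*,x_* )$ is the Perron pair of $\mathcal{A}$.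
   Context: $\mathbb{R}^{[m,n]}$ is the set of $m$th-order $n$-dimensional real tensors $\mathcal{A}=(A_{i_1\ldots i_m})$, $1\le i_1,\dots,i_m\le n$; $\mathbb{R}_{+}^{[m,n]}$ and $\mathbb{R}_{++}^{[m,n]}$ are those with all entries nonnegative, respectively positive. $\mathbb{R}_{++}$ is the set of positive reals and $\mathbb{R}_{++}^n$ the set of vectors with all entries positive; $\|\cdot\|$ is the Euclidean norm. For $x\in\mathbb{C}^n$, $\mathcal{A}x^{m-1}\in\mathbb{C}^n$ is the vector with entries $(\mathcal{A}x^{m-1})_i=\sum_{i_2,\dots,i_m=1}^n A_{ii_2\cdots i_m}x_{i_2}\cdots x_{i_m}$, and $x^{[\alpha]}=[x_1^\alpha,\dots,x_n^\alpha]^T$. A pair $(\lambda,x)\in\mathbb{C}\times(\mathbb{C}^n\setminus\{0\})$ is an eigenpair of $\mathcal{A}$ if $\mathcal{A}x^{m-1}=\lambda x^{[m-1]}$. It is a nonnegative eigenpair if $\lambda\ge0$ is real and $x$ is a real vector with all entries nonnegative. $\mathcal{A}$ is reducible if there is a nonempty proper subset $I$ of $N=\{1,\dots,n\}$ such that $A_{i_1i_2\ldots i_m}=0$ for all $i_1\in I$ and all $i_2,\dots,i_m\in N\setminus I$; it is irreducible if it is not reducible. The spectral radius is $\rho(\mathcal{A})=\max\{|\lambda|:\lambda\text{ is an eigenvalue of }\mathcal{A}\}$. For an irreducible nonnegative tensor $\mathcal{A}$, the Perron pair is $(\lambda_*,x_* )$ with $\lambda_*=\rho(\mathcal{A})$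 and $x_*$ the (unique) nonnegative eigenvector corresponding to $\lambda_*$ normalized by $x_*^Tx_*=1$. *)

theory Defs
  imports "HOL-Analysis.Analysis"
begin

text \<open>
  An \<open>m\<close>th-order tensor of dimension \<open>n = CARD('n)\<close> is a function on index lists over \<open>'n\<close>; only
  its values on lists of length \<open>m\<close> are meaningful, and the entry with indices
  \<open>i, i\<^sub>2, \<dots>, i\<^sub>m\<close> is its value at \<open>i # [i\<^sub>2, \<dots>, i\<^sub>m]\<close>.
\<close>

type_synonym 'n tensor = "'n list \<Rightarrow> real"

definition nonneg_tensor :: "nat \<Rightarrow> 'n tensor \<Rightarrow> bool" where
  "nonneg_tensor m A \<longleftrightarrow> (\<forall>is. length is = m \<longrightarrow> 0 \<le> A is)"

definition nonneg_vec :: "real ^ 'n \<Rightarrow> bool" where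
  "nonneg_vec x \<longleftrightarrow> (\<forall>i. 0 \<le> x $ i)"

definition positive_vec :: "real ^ 'n \<Rightarrow> bool" where
  "positive_vec x \<longleftrightarrow> (\<forall>i. 0 < x $ i)"

text \<open>The vector \<open>A x\<^sup>m\<^sup>-\<^sup>1\<close>, used both for real and for complex \<open>x\<close>.\<close>

definition tensor_apply :: "nat \<Rightarrow> 'n::finite tensor \<Rightarrow> 'a::real_field ^ 'n \<Rightarrow> 'a ^ 'n" where
  "tensor_apply m A x =
     (\<chi> i. \<Sum>js | length js = m - 1. of_real (A (i # js)) * (\<Prod>j\<leftarrow>js. x $ j))"

definition vec_power :: "'a::real_field ^ 'n \<Rightarrow> nat \<Rightarrow> 'a ^ 'n" where
  "vec_power x k = (\<chi> i. (x $ i) ^ k)"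

definition eigenpair :: "nat \<Rightarrow> 'n::finite tensor \<Rightarrow> complex \<Rightarrow> complex ^ 'n \<Rightarrow> bool" where
  "eigenpair m A l x \<longleftrightarrow> x \<noteq> 0 \<and> tensor_apply m A x = l *s vec_power x (m - 1)"

definition eigenvalue :: "nat \<Rightarrow> 'n::finite tensor \<Rightarrow> complex \<Rightarrow> bool" where
  "eigenvalue m A l \<longleftrightarrow> (\<exists>x. eigenpair m A l x)"

definition nonneg_eigenpair :: "nat \<Rightarrow> 'n::finite tensor \<Rightarrow> real \<Rightarrow> real ^ 'n \<Rightarrow> bool" where
  "nonneg_eigenpair m A l x \<longleftrightarrow>
     0 \<le> l \<and> nonneg_vec x \<and> eigenpair m A (of_real l) (\<chi> i. of_real (x $ i))"

definition reducible_tensor :: "nat \<Rightarrow> 'n tensor \<Rightarrow> bool" where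
  "reducible_tensor m A \<longleftrightarrow>
     (\<exists>I. I \<noteq> {} \<and> I \<noteq> UNIV \<and>
        (\<forall>i\<in>I. \<forall>js. length js = m - 1 \<and> set js \<subseteq> UNIV - I \<longrightarrow> A (i # js) = 0))"

definition irreducible_tensor :: "nat \<Rightarrow> 'n tensor \<Rightarrow> bool" where
  "irreducible_tensor m A \<longleftrightarrow> \<not> reducible_tensor m A"

text \<open>
  \<open>GREATEST\<close> is the maximum of the set of moduli; unlike \<open>Max\<close> it does not presuppose that
  this set is finite.
\<close>

definition spectral_radius :: "nat \<Rightarrow> 'n::finite tensor \<Rightarrow> real" where
  "spectral_radius m A = (GREATEST r. r \<in> cmod ` {l. eigenvalue m A l})"

text \<open>Well defined for irreducible nonnegative tensors of order at least 2.\<close>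

definition perron_pair :: "nat \<Rightarrow> 'n::finite tensor \<Rightarrow> real \<times> (real ^ 'n)" where
  "perron_pair m A =
     (spectral_radius m A,
      THE x. nonneg_eigenpair m A (spectral_radius m A) x \<and> x \<bullet> x = 1)"

definition start_tensor :: "nat \<Rightarrow> real ^ 'n \<Rightarrow> real ^ 'n \<Rightarrow> 'n tensor" where
  "start_tensor m a b = (\<lambda>is. (a $ hd is) ^ (m - 1) * (\<Prod>j\<leftarrow>tl is. b $ j))"

definition homotopy ::
  "nat \<Rightarrow> 'n::finite tensor \<Rightarrow> real ^ 'n \<Rightarrow> real ^ 'n \<Rightarrow>
   real \<Rightarrow> real ^ 'n \<Rightarrow> real \<Rightarrow> (real ^ 'n) \<times> real" where
  "homotopy m A a b l x t =
     (tensor_apply m (\<lambda>is. t * A is + (1 - t) * start_tensor m a b is) x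
        - l *s vec_power x (m - 1),
      x \<bullet> x - 1)"

text \<open>Limit points of \<open>f t\<close> as \<open>t\<close> tends to \<open>1\<close> from the left, for \<open>f\<close> given on \<open>[0, 1)\<close>.\<close>

definition limit_point_at_1 :: "(real \<Rightarrow> 'a::metric_space) \<Rightarrow> 'a \<Rightarrow> bool" where
  "limit_point_at_1 f p \<longleftrightarrow>
     (\<exists>s. (\<forall>k::nat. s k \<in> {0..<1}) \<and> s \<longlonglongrightarrow> 1 \<and> (\<lambda>k. f (s k)) \<longlonglongrightarrow> p)"

end

theory Submission imports Defs begin

text \<open>
  Along the curve \<open>x t\<close> stays on the unit sphere and \<open>lam t\<close> is bounded by the sum of all entries
  (look at a largest coordinate), so the curve is relatively compact, and by continuity every
  limit point is a normalized nonnegative eigenpair of \<open>A\<close>.  If \<open>A\<close> is irreducible, such a pair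
  is unique and equals the Perron pair, by comparing a vector \<open>z\<close> with the smallest multiple of a
  positive eigenvector \<open>y\<close> dominating it.  A relatively compact curve with a single limit point
  converges.
\<close>

section \<open>Products over index lists: comparison, positivity, limits\<close>

lemma norm_prod_list_map_le:
  fixes z :: "'i \<Rightarrow> 'a::real_normed_field"
  assumes "\<And>j. norm (z j) \<le> c * y j"
  shows "norm (\<Prod>j\<leftarrow>js. z j) \<le> c ^ length js * (\<Prod>j\<leftarrow>js. y j)"
proof (induction js)
  case (Cons k js)
  have "norm (\<Prod>j\<leftarrow>k # js. z j) = norm (z k) * norm (\<Prod>j\<leftarrow>js. z j)"
    by (simp add: norm_mult)
  also have "\<dots> \<le> (c * y k) * (c ^ length js * (\<Prod>j\<leftarrow>js. y j))"
    by (rule mult_mono[OF assms Cons.IH order_trans[OF norm_ge_zero assms] norm_ge_zero])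
  finally show ?case by (simp add: algebra_simps)
qed simp

text \<open>For the empty list both products are 1, so strictness needs at least one factor; index
  lists of length \<open>m - 1\<close> with \<open>m \<ge> 2\<close> provide it.\<close>

lemma prod_list_map_less:
  fixes y z :: "'i \<Rightarrow> real"
  assumes "js \<noteq> []" "\<And>j. j \<in> set js \<Longrightarrow> 0 \<le> z j \<and> z j < c * y j"
  shows "0 \<le> (\<Prod>j\<leftarrow>js. z j) \<and> (\<Prod>j\<leftarrow>js. z j) < c ^ length js * (\<Prod>j\<leftarrow>js. y j)"
  using assms
proof (induction js rule: list_nonempty_induct)
  case (cons k js)
  have IH: "0 \<le> (\<Prod>j\<leftarrow>js. z j)" "(\<Prod>j\<leftarrow>js. z j) < c ^ length js * (\<Prod>j\<leftarrow>js. y j)"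
    using cons by auto
  have k: "0 \<le> z k" "z k < c * y k" using cons.prems by auto
  have "z k * (\<Prod>j\<leftarrow>js. z j) < (c * y k) * (c ^ length js * (\<Prod>j\<leftarrow>js. y j))"
    using k IH by (intro mult_strict_mono) linarith+
  then show ?case using k IH by (simp add: algebra_simps)
qed simp

lemma prod_list_map_pos:
  fixes z :: "'i \<Rightarrow> real"
  assumes "\<And>j. j \<in> set js \<Longrightarrow> 0 < z j"
  shows "0 < (\<Prod>j\<leftarrow>js. z j)"
  using assms by (induction js) auto

lemma tendsto_prod_list_map:
  fixes f :: "'i \<Rightarrow> 'b \<Rightarrow> real"
  assumes "\<And>j. (f j \<longlongrightarrow> g j) F"
  shows "((\<lambda>k. \<Prod>j\<leftarrow>js. f j k) \<longlongrightarrow> (\<Prod>j\<leftarrow>js. g j)) F"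
  by (induction js) (auto intro!: tendsto_mult assms)

lemma of_real_prod_list_map:
  "of_real (\<Prod>j\<leftarrow>js. f j) = (\<Prod>j\<leftarrow>js. of_real (f j) :: 'a::real_field)"
  by (induction js) auto

lemma finite_index_lists [simp]: "finite {js :: 'n::finite list. length js = k}"
  using finite_lists_length_eq[OF finite, of UNIV k] by simp

section \<open>Perron-Frobenius theory of nonnegative eigenpairs\<close>

lemma nonneg_eigenpair_iff:
  "nonneg_eigenpair m A l x \<longleftrightarrow>
     0 \<le> l \<and> nonneg_vec x \<and> x \<noteq> 0 \<and> tensor_apply m A x = l *s vec_power x (m - 1)"
proof -
  \<comment> \<open>The entries of \<open>A\<close> are real, so applying \<open>A\<close> commutes
    with the embedding of real vectors into complex ones; eigenpairs can then be handled in real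
    arithmetic.\<close>
  have "tensor_apply m A (\<chi> i. of_real (x $ i)) = (\<chi> i. complex_of_real (tensor_apply m A x $ i))"
    by (simp add: tensor_apply_def of_real_prod_list_map vec_eq_iff)
  moreover have "of_real l *s vec_power (\<chi> i. of_real (x $ i)) (m - 1) =
      (\<chi> i. complex_of_real ((l *s vec_power x (m - 1)) $ i))"
    by (simp add: vec_power_def vec_eq_iff)
  ultimately show ?thesis
    by (simp add: nonneg_eigenpair_def eigenpair_def vec_eq_iff del: of_real_mult flip: of_real_mult)
qed

lemma nonneg_eigenpairD:
  assumes "nonneg_eigenpair m A l x"
  shows "(\<Sum>js | length js = m - 1. A (i # js) * (\<Prod>j\<leftarrow>js. x $ j)) = l * (x $ i) ^ (m - 1)"
  using assms
  by (simp add: nonneg_eigenpair_iff tensor_apply_def vec_power_def vec_eq_iff)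

text \<open>The zero set \<open>I\<close> of \<open>x\<close> would witness reducibility: in a row
  \<open>i\<close> of \<open>I\<close> the nonnegative terms sum to 0, so each vanishes, and a
  monomial in coordinates outside \<open>I\<close> is positive, which forces its coefficient to be
  0.\<close>

lemma nonneg_eigenvector_positive:
  assumes "m \<ge> 2" "nonneg_tensor m A" "irreducible_tensor m A" "nonneg_eigenpair m A l x"
  shows "positive_vec x"
proof (rule ccontr)
  assume "\<not> positive_vec x"
  have x: "0 \<le> x $ i" for i
    using assms(4) by (simp add: nonneg_eigenpair_iff nonneg_vec_def)
  define I where "I = {i. x $ i = 0}"
  have "I \<noteq> {}" using \<open>\<not> positive_vec x\<close> x unfolding I_def positive_vec_def
    by (metis (mono_tags, lifting) empty_iff mem_Collect_eq order_le_less)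
  moreover have "I \<noteq> UNIV" using assms(4) by (auto simp: nonneg_eigenpair_iff I_def vec_eq_iff)
  moreover have "A (i # js) = 0" if "i \<in> I" "length js = m - 1" "set js \<subseteq> UNIV - I" for i js
  proof -
    \<comment> \<open>Here \<open>m \<ge> 2\<close> matters: \<open>0 ^ (m - 1)\<close> is 0 only
      for a positive exponent.\<close>
    have "(\<Sum>js | length js = m - 1. A (i # js) * (\<Prod>j\<leftarrow>js. x $ j)) = 0"
      using nonneg_eigenpairD[OF assms(4), of i] that(1) assms(1) by (simp add: I_def)
    moreover have "0 \<le> A (i # js) * (\<Prod>j\<leftarrow>js. x $ j)" if "length js = m - 1" for js
      using that assms(1,2) x
      by (intro mult_nonneg_nonneg prod_list_nonneg) (auto simp: nonneg_tensor_def)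
    ultimately have "A (i # js) * (\<Prod>j\<leftarrow>js. x $ j) = 0"
      using that(2) by (subst (asm) sum_nonneg_eq_0_iff) auto
    moreover have "0 < (\<Prod>j\<leftarrow>js. x $ j)"
      by (rule prod_list_map_pos) (use that(3) x in \<open>force simp: I_def order_less_le\<close>)
    ultimately show ?thesis by simp
  qed
  ultimately show False
    using assms(3) unfolding irreducible_tensor_def reducible_tensor_def by blast
qed

text \<open>The multiple is the largest ratio \<open>z j / y $ j\<close>; contact happens at an
  index where this maximum is attained.\<close>

lemma exists_least_dominating_multiple:
  fixes y :: "real ^ 'n::finite" and z :: "'n \<Rightarrow> real"
  assumes "positive_vec y"
  obtains c i where "\<And>j. z j \<le> c * y $ j" "z i = c * y $ i"
proof -
  define c where "c = Max (range (\<lambda>j. z j / y $ j))"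
  have y: "0 < y $ j" for j using assms by (simp add: positive_vec_def)
  have "c \<in> range (\<lambda>j. z j / y $ j)" unfolding c_def by (rule Max_in) auto
  then obtain i where "c = z i / y $ i" by auto
  then have "z i = c * y $ i" using y[of i] by simp
  moreover have "z j \<le> c * y $ j" for j
  proof -
    have "z j / y $ j \<le> c" unfolding c_def by (rule Max_ge) auto
    then show ?thesis using y[of j] by (simp add: pos_divide_le_eq)
  qed
  ultimately show ?thesis using that by blast
qed

text \<open>In row \<open>i\<close>, where \<open>c * y\<close> touches the moduli of
  \<open>z\<close>, the triangle inequality bounds the left side by the row of \<open>c * y\<close>,
  which equals \<open>\<mu> * (c * y $ i) ^ (m - 1)\<close>.\<close>

lemma eigenvalue_cmod_le:
  assumes "m \<ge> 2" "nonneg_tensor m A" "nonneg_eigenpair m A \<mu> y" "positive_vec y"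
    and "eigenvalue m A l"
  shows "cmod l \<le> \<mu>"
proof -
  obtain z where z: "z \<noteq> 0" "tensor_apply m A z = l *s vec_power z (m - 1)"
    using assms(5) by (auto simp: eigenvalue_def eigenpair_def)
  obtain c i where c: "\<And>j. cmod (z $ j) \<le> c * y $ j" "cmod (z $ i) = c * y $ i"
    using exists_least_dominating_multiple[OF assms(4), of "\<lambda>j. cmod (z $ j)"] by blast
  have y: "0 < y $ j" for j using assms(4) by (simp add: positive_vec_def)
  \<comment> \<open>This makes \<open>cmod (z $ i)\<close> positive, so that its power can be
    cancelled at the end.\<close>
  have "c > 0"
  proof -
    obtain j where "z $ j \<noteq> 0" using z(1) by (auto simp: vec_eq_iff)
    then have "0 < c * y $ j" using c(1)[of j] by (meson less_le_trans zero_less_norm_iff)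
    then show ?thesis using y[of j] by (simp add: zero_less_mult_iff)
  qed
  have "cmod l * cmod (z $ i) ^ (m - 1) = cmod (l * (z $ i) ^ (m - 1))"
    by (simp add: norm_mult norm_power)
  also have "l * (z $ i) ^ (m - 1) =
      (\<Sum>js | length js = m - 1. of_real (A (i # js)) * (\<Prod>j\<leftarrow>js. z $ j))"
    using z(2) by (simp add: tensor_apply_def vec_power_def vec_eq_iff)
  also have "cmod \<dots> \<le> (\<Sum>js | length js = m - 1. A (i # js) * (c ^ (m - 1) * (\<Prod>j\<leftarrow>js. y $ j)))"
  proof (rule sum_norm_le)
    fix js :: "'a list" assume "js \<in> {js. length js = m - 1}"
    then have js: "length js = m - 1" by simp
    then have "0 \<le> A (i # js)" using assms(1,2) by (auto simp: nonneg_tensor_def)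
    moreover have "cmod (\<Prod>j\<leftarrow>js. z $ j) \<le> c ^ (m - 1) * (\<Prod>j\<leftarrow>js. y $ j)"
      using norm_prod_list_map_le[OF c(1), where js=js] js by simp
    ultimately show "cmod (of_real (A (i # js)) * (\<Prod>j\<leftarrow>js. z $ j)) \<le>
        A (i # js) * (c ^ (m - 1) * (\<Prod>j\<leftarrow>js. y $ j))"
      by (simp add: norm_mult mult_left_mono)
  qed
  also have "\<dots> = c ^ (m - 1) * (\<Sum>js | length js = m - 1. A (i # js) * (\<Prod>j\<leftarrow>js. y $ j))"
    by (simp add: sum_distrib_left algebra_simps)
  also have "\<dots> = \<mu> * cmod (z $ i) ^ (m - 1)"
    by (simp add: nonneg_eigenpairD[OF assms(3)] c(2) power_mult_distrib del: One_nat_def)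
  finally show ?thesis using c(2) \<open>c > 0\<close> y[of i] by (simp add: mult_le_cancel_right)
qed

lemma spectral_radius_eq:
  assumes "m \<ge> 2" "nonneg_tensor m A" "nonneg_eigenpair m A \<mu> y" "positive_vec y"
  shows "spectral_radius m A = \<mu>"
proof -
  have "eigenvalue m A (of_real \<mu>)" "0 \<le> \<mu>"
    using assms(3) by (auto simp: nonneg_eigenpair_def eigenvalue_def)
  then have "\<mu> \<in> cmod ` {l. eigenvalue m A l}"
    by (metis image_eqI mem_Collect_eq norm_of_real abs_of_nonneg)
  then show ?thesis unfolding spectral_radius_def
    by (rule Greatest_equality) (use eigenvalue_cmod_le[OF assms] in auto)
qed

text \<open>Let \<open>J\<close> be the contact set of \<open>z\<close> with its least dominating
  multiple \<open>c * y\<close>. If \<open>J\<close> were proper it would witness reducibility, so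
  the two vectors agree everywhere, and the normalization gives \<open>c = 1\<close>.\<close>

lemma positive_eigenvector_unique:
  assumes "m \<ge> 2" "nonneg_tensor m A" "irreducible_tensor m A"
    and y: "nonneg_eigenpair m A \<mu> y" "positive_vec y" "y \<bullet> y = 1"
    and z: "nonneg_eigenpair m A \<mu> z" "positive_vec z" "z \<bullet> z = 1"
  shows "z = y"
proof -
  obtain c i where c: "\<And>j. z $ j \<le> c * y $ j" "z $ i = c * y $ i"
    using exists_least_dominating_multiple[OF y(2), of "\<lambda>j. z $ j"] by blast
  have pos: "0 < y $ j" "0 < z $ j" for j using y(2) z(2) by (simp_all add: positive_vec_def)
  have "c > 0" using pos[of i] c(2) by (simp add: zero_less_mult_iff)
  define J where "J = {j. z $ j = c * y $ j}"
  have "J \<noteq> {}" using c(2) by (auto simp: J_def)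
  have "A (i # js) = 0" if "i \<in> J" "length js = m - 1" "set js \<subseteq> UNIV - J" for i js
  proof -
    \<comment> \<open>\<open>?d\<close> is the gap between the monomials of \<open>c * y\<close> and
      \<open>z\<close>: nonnegative for all index lists of length \<open>m - 1\<close>, strictly
      positive when all indices avoid \<open>J\<close>.\<close>
    let ?d = "\<lambda>js. c ^ (m - 1) * (\<Prod>j\<leftarrow>js. y $ j) - (\<Prod>j\<leftarrow>js. z $ j)"
    have "(\<Sum>js | length js = m - 1. A (i # js) * ?d js) =
        c ^ (m - 1) * (\<Sum>js | length js = m - 1. A (i # js) * (\<Prod>j\<leftarrow>js. y $ j)) -
        (\<Sum>js | length js = m - 1. A (i # js) * (\<Prod>j\<leftarrow>js. z $ j))"
      by (simp add: sum_distrib_left sum_subtractf algebra_simps)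
    \<comment> \<open>Both eigenvectors have eigenvalue \<open>\<mu>\<close>, and for
      \<open>i\<close> in \<open>J\<close> both rows equal
      \<open>\<mu> * (c * y $ i) ^ (m - 1)\<close>.\<close>
    also have "\<dots> = 0"
      using that(1) by (simp add: nonneg_eigenpairD[OF y(1)] nonneg_eigenpairD[OF z(1)] J_def
          power_mult_distrib del: One_nat_def)
    finally have "(\<Sum>js | length js = m - 1. A (i # js) * ?d js) = 0" .
    moreover have "0 \<le> A (i # js) * ?d js" if "length js = m - 1" for js
    proof -
      have "norm (z $ j) \<le> c * y $ j" for j using c(1)[of j] pos(2)[of j] by simp
      from norm_prod_list_map_le[of "\<lambda>j. z $ j" c "\<lambda>j. y $ j", OF this, of js] that
      have "0 \<le> ?d js" by simp
      then show ?thesis using that assms(1,2) by (auto simp: nonneg_tensor_def)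
    qed
    ultimately have "A (i # js) * ?d js = 0"
      using that(2) by (subst (asm) sum_nonneg_eq_0_iff) auto
    moreover have "0 < ?d js"
    proof -
      have "js \<noteq> []" using that(2) assms(1) by auto
      moreover have "0 \<le> z $ j \<and> z $ j < c * y $ j" if "j \<in> set js" for j
        using that \<open>set js \<subseteq> UNIV - J\<close> c(1)[of j] pos(2)[of j] by (auto simp: J_def order_less_le)
      ultimately show ?thesis using prod_list_map_less[of js "\<lambda>j. z $ j" c "\<lambda>j. y $ j"] that(2)
        by simp
    qed
    ultimately show ?thesis by simp
  qed
  then have "J = UNIV"
    using assms(3) \<open>J \<noteq> {}\<close> unfolding irreducible_tensor_def reducible_tensor_def by blast
  then have eq: "z = c *\<^sub>R y" by (auto simp: J_def vec_eq_iff)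
  then have "c * c = 1" using y(3) z(3) by simp
  then have "c = 1" using \<open>c > 0\<close> by (simp add: square_eq_1_iff)
  then show ?thesis using eq by simp
qed

text \<open>Irreducibility makes any nonnegative eigenvector positive, which identifies its
  eigenvalue as the spectral radius. Existence of a Perron pair is not presupposed: limit points of
  the curve will supply the pair.\<close>

lemma perron_pair_eq:
  assumes "m \<ge> 2" "nonneg_tensor m A" "irreducible_tensor m A"
    and "nonneg_eigenpair m A \<mu> y" "y \<bullet> y = 1"
  shows "perron_pair m A = (\<mu>, y)"
proof -
  note pos = nonneg_eigenvector_positive[OF assms(1-3)]
  have "spectral_radius m A = \<mu>"
    using spectral_radius_eq[OF assms(1,2,4) pos[OF assms(4)]] .
  moreover have "(THE x. nonneg_eigenpair m A \<mu> x \<and> x \<bullet> x = 1) = y"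
    using positive_eigenvector_unique[OF assms(1-3)] pos assms(4,5)
    by (intro the_equality) auto
  ultimately show ?thesis by (simp add: perron_pair_def)
qed

section \<open>Compactness of the homotopy curve and its limit points\<close>

lemma positive_eigenvalue_le_sum:
  fixes x :: "real ^ 'n::finite"
  assumes "positive_vec x" "tensor_apply m B x = l *s vec_power x (m - 1)"
  shows "l \<le> (\<Sum>i\<in>UNIV. \<Sum>js | length js = m - 1. \<bar>B (i # js)\<bar>)"
proof -
  have x: "0 < x $ j" for j using assms(1) by (simp add: positive_vec_def)
  \<comment> \<open>Comparing with the all-ones vector \<open>1\<close> makes \<open>c\<close> the
    largest coordinate of \<open>x\<close>.\<close>
  obtain c i where c: "\<And>j. x $ j \<le> c" "x $ i = c"
    using exists_least_dominating_multiple[of 1 "\<lambda>j. x $ j"] by (auto simp: positive_vec_def)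
  have "l * c ^ (m - 1) = (\<Sum>js | length js = m - 1. B (i # js) * (\<Prod>j\<leftarrow>js. x $ j))"
    using assms(2) c(2) by (simp add: tensor_apply_def vec_power_def vec_eq_iff)
  also have "\<dots> \<le> (\<Sum>js | length js = m - 1. \<bar>B (i # js)\<bar> * c ^ (m - 1))"
  proof (rule sum_mono)
    fix js :: "'n list" assume "js \<in> {js. length js = m - 1}"
    moreover have "norm (x $ j) \<le> c * 1" for j using c(1)[of j] x[of j] by simp
    note norm_prod_list_map_le[OF this, where js=js]
    ultimately have "\<bar>\<Prod>j\<leftarrow>js. x $ j\<bar> \<le> c ^ (m - 1)" by (simp add: map_replicate_const)
    then have "\<bar>B (i # js) * (\<Prod>j\<leftarrow>js. x $ j)\<bar> \<le> \<bar>B (i # js)\<bar> * c ^ (m - 1)"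
      by (simp add: abs_mult mult_left_mono)
    then show "B (i # js) * (\<Prod>j\<leftarrow>js. x $ j) \<le> \<bar>B (i # js)\<bar> * c ^ (m - 1)" by simp
  qed
  also have "\<dots> = (\<Sum>js | length js = m - 1. \<bar>B (i # js)\<bar>) * c ^ (m - 1)"
    by (simp add: sum_distrib_right)
  finally have "l \<le> (\<Sum>js | length js = m - 1. \<bar>B (i # js)\<bar>)"
    using x[of i] c(2) by (simp add: mult_le_cancel_right)
  \<comment> \<open>The row \<open>i\<close> depends on \<open>x\<close>; summing over all rows
    gives a bound that does not.\<close>
  also have "\<dots> \<le> (\<Sum>i\<in>UNIV. \<Sum>js | length js = m - 1. \<bar>B (i # js)\<bar>)"
    by (rule member_le_sum) (auto intro: sum_nonneg)
  finally show ?thesis .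
qed

text \<open>The equations pass to the limit by continuity, while positivity survives only as
  nonnegativity. The normalization also passes to the limit and keeps \<open>y\<close> away from
  0.\<close>

lemma limit_point_nonneg_eigenpair:
  assumes curve: "\<And>t. t \<in> {0..<1} \<Longrightarrow>
           0 < lam t \<and> positive_vec (x t) \<and> homotopy m A a b (lam t) (x t) t = 0"
    and "limit_point_at_1 (\<lambda>t. (lam t, x t)) (\<mu>, y)"
  shows "nonneg_eigenpair m A \<mu> y \<and> y \<bullet> y = 1"
proof -
  obtain s where s: "\<And>k::nat. s k \<in> {0..<1}" "s \<longlonglongrightarrow> 1" "(\<lambda>k. (lam (s k), x (s k))) \<longlonglongrightarrow> (\<mu>, y)"
    using assms(2) unfolding limit_point_at_1_def by auto
  have l: "(\<lambda>k. lam (s k)) \<longlonglongrightarrow> \<mu>" using tendsto_fst[OF s(3)] by simp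
  have xv: "(\<lambda>k. x (s k)) \<longlonglongrightarrow> y" using tendsto_snd[OF s(3)] by simp
  have xj: "(\<lambda>k. x (s k) $ j) \<longlonglongrightarrow> y $ j" for j by (rule tendsto_vec_nth[OF xv])
  note ck = curve[OF s(1)]
  have "0 \<le> \<mu>" by (rule LIMSEQ_le_const[OF l]) (use ck in \<open>auto intro: less_imp_le\<close>)
  moreover have "nonneg_vec y" unfolding nonneg_vec_def
    by (intro allI LIMSEQ_le_const[OF xj])
      (use ck in \<open>auto simp: positive_vec_def intro: less_imp_le\<close>)
  moreover have yy: "y \<bullet> y = 1"
  proof (rule LIMSEQ_unique)
    show "(\<lambda>k. x (s k) \<bullet> x (s k)) \<longlonglongrightarrow> y \<bullet> y" by (intro tendsto_inner xv)
    show "(\<lambda>k. x (s k) \<bullet> x (s k)) \<longlonglongrightarrow> 1" using ck by (simp add: homotopy_def zero_prod_def)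
  qed
  moreover have "tensor_apply m A y = \<mu> *s vec_power y (m - 1)"
    unfolding vec_eq_iff
  proof
    fix i
    let ?B = "\<lambda>t is. t * A is + (1 - t) * start_tensor m a b is"
    let ?f = "\<lambda>k. \<Sum>js | length js = m - 1. ?B (s k) (i # js) * (\<Prod>j\<leftarrow>js. x (s k) $ j)"
    \<comment> \<open>At parameter 1 the start tensor has coefficient 0, so \<open>?B 1\<close> is
      \<open>A\<close>.\<close>
    have "?f \<longlonglongrightarrow> (\<Sum>js | length js = m - 1. ?B 1 (i # js) * (\<Prod>j\<leftarrow>js. y $ j))"
      by (intro tendsto_intros tendsto_prod_list_map s(2) xj)
    moreover have "?f = (\<lambda>k. lam (s k) * (x (s k) $ i) ^ (m - 1))"
      using ck by (auto simp: homotopy_def zero_prod_def tensor_apply_def vec_power_def vec_eq_iff)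
    moreover have "(\<lambda>k. lam (s k) * (x (s k) $ i) ^ (m - 1)) \<longlonglongrightarrow> \<mu> * (y $ i) ^ (m - 1)"
      by (intro tendsto_intros l xj)
    ultimately show "tensor_apply m A y $ i = (\<mu> *s vec_power y (m - 1)) $ i"
      by (auto simp: tensor_apply_def vec_power_def dest: LIMSEQ_unique)
  qed
  moreover have "y \<noteq> 0" using yy by auto
  ultimately show ?thesis by (simp add: nonneg_eigenpair_iff)
qed

lemma curve_in_compact:
  fixes A :: "'n::finite tensor"
  assumes curve: "\<And>t. t \<in> {0..<1} \<Longrightarrow>
           0 < lam t \<and> positive_vec (x t) \<and> homotopy m A a b (lam t) (x t) t = 0"
  obtains K where "compact K" "\<And>t. t \<in> {0..<1} \<Longrightarrow> (lam t, x t) \<in> K"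
proof
  let ?E = "start_tensor m a b"
  let ?C = "\<Sum>i\<in>UNIV. \<Sum>js | length js = m - 1. \<bar>A (i # js)\<bar> + \<bar>?E (i # js)\<bar>"
  show "compact ({0..?C} \<times> cball 0 1 :: (real \<times> (real ^ 'n)) set)"
    by (intro compact_Times compact_Icc compact_cball)
  fix t :: real assume t: "t \<in> {0..<1}"
  have h: "tensor_apply m (\<lambda>is. t * A is + (1 - t) * ?E is) (x t) = lam t *s vec_power (x t) (m - 1)"
    and n: "x t \<bullet> x t = 1"
    using curve[OF t] by (auto simp: homotopy_def zero_prod_def)
  \<comment> \<open>Removes \<open>t\<close> from the eigenvalue bound, so that one compact set
    serves the whole curve.\<close>
  have "\<bar>t * p + (1 - t) * q\<bar> \<le> \<bar>p\<bar> + \<bar>q\<bar>" for p q :: real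
    using t by (intro order_trans[OF abs_triangle_ineq] add_mono)
      (auto simp: abs_mult intro!: mult_left_le_one_le)
  then have "lam t \<le> ?C"
    using curve[OF t]
    by (intro order_trans[OF positive_eigenvalue_le_sum[OF _ h]] sum_mono) auto
  then show "(lam t, x t) \<in> {0..?C} \<times> cball 0 1"
    using curve[OF t] n by (auto simp: norm_eq_sqrt_inner)
qed

text \<open>Otherwise some sequence tending to 1 has infinitely many values at distance at least
  \<open>e\<close> from \<open>L\<close>; compactness extracts from these a limit point, which would
  have to be \<open>L\<close>.\<close>

lemma tendsto_at_left_1_if_limit_points_eq:
  fixes f :: "real \<Rightarrow> 'a::metric_space"
  assumes "compact K" "\<And>t. t \<in> {0..<1} \<Longrightarrow> f t \<in> K"
    and unique: "\<And>p. limit_point_at_1 f p \<Longrightarrow> p = L"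
  shows "(f \<longlongrightarrow> L) (at_left 1)"
\<comment> \<open>The lower bound 0 keeps the test sequences inside the domain of the curve.\<close>
proof (rule tendsto_at_left_sequentially[of 0])
  fix S :: "nat \<Rightarrow> real"
  assume S: "\<And>n. S n < 1" "\<And>n. 0 < S n" "S \<longlonglongrightarrow> 1"
  show "(\<lambda>n. f (S n)) \<longlonglongrightarrow> L"
  proof (rule ccontr)
    assume "\<not> ?thesis"
    then obtain e where e: "e > 0" "\<exists>\<^sub>F n in sequentially. dist (f (S n)) L \<ge> e"
      by (auto simp: tendsto_iff frequently_def not_le)
    have inf: "infinite {n. dist (f (S n)) L \<ge> e}"
      using e(2) by (simp add: INFM_iff_infinite cofinite_eq_sequentially[symmetric])
    define r where "r = enumerate {n. dist (f (S n)) L \<ge> e}"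
    have r: "strict_mono r" "dist (f (S (r n))) L \<ge> e" for n
      using strict_mono_enumerate[OF inf] enumerate_in_set[OF inf, of n] by (auto simp: r_def)
    have "\<forall>n. f (S (r n)) \<in> K" using S by (auto intro!: assms(2) less_imp_le)
    then obtain p q where q: "strict_mono q" "((\<lambda>n. f (S (r n))) \<circ> q) \<longlonglongrightarrow> p"
      using compact_imp_seq_compact[OF assms(1)] by (metis seq_compactE)
    have "(S \<circ> (r \<circ> q)) \<longlonglongrightarrow> 1"
      by (intro LIMSEQ_subseq_LIMSEQ S(3) strict_mono_o r(1) q(1))
    then have "limit_point_at_1 f p" unfolding limit_point_at_1_def
      using q(2) S by (intro exI[of _ "S \<circ> (r \<circ> q)"]) (auto simp: o_def intro: less_imp_le)
    then have "((\<lambda>n. f (S (r n))) \<circ> q) \<longlonglongrightarrow> L" using q(2) unique by blast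
    then have "\<forall>\<^sub>F n in sequentially. dist (f (S (r (q n)))) L < e"
      using tendstoD[OF _ e(1)] by (force simp: o_def)
    then show False using r(2) by (simp add: not_less[symmetric])
  qed
qed simp

theorem theorem2p1:
  fixes A :: "'n::finite tensor" and a b :: "real ^ 'n" and m :: nat
    and lam :: "real \<Rightarrow> real" and x :: "real \<Rightarrow> real ^ 'n"
  assumes "m \<ge> 2"
    and "nonneg_tensor m A"
    and "positive_vec a" and "positive_vec b"
    and "lam 0 = (a \<bullet> b) ^ (m - 1)" and "x 0 = a /\<^sub>R norm a"
    and "\<And>t. t \<in> {0..<1} \<Longrightarrow>
           0 < lam t \<and> positive_vec (x t) \<and> homotopy m A a b (lam t) (x t) t = 0"
  shows "(\<forall>\<mu> y. limit_point_at_1 (\<lambda>t. (lam t, x t)) (\<mu>, y) \<longrightarrow> nonneg_eigenpair m A \<mu> y) \<and>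
         (irreducible_tensor m A \<longrightarrow>
           ((\<lambda>t. (lam t, x t)) \<longlongrightarrow> perron_pair m A) (at_left 1))"
proof -
  note limit = limit_point_nonneg_eigenpair[of lam x, OF assms(7)]
  obtain K where K: "compact K" "\<And>t. t \<in> {0..<1} \<Longrightarrow> (lam t, x t) \<in> K"
    using curve_in_compact[of lam x, OF assms(7)] by blast
  have "((\<lambda>t. (lam t, x t)) \<longlongrightarrow> perron_pair m A) (at_left 1)" if "irreducible_tensor m A"
  proof (rule tendsto_at_left_1_if_limit_points_eq[OF K])
    fix p assume "limit_point_at_1 (\<lambda>t. (lam t, x t)) p"
    \<comment> \<open>\<open>limit\<close> also yields the normalization that
      \<open>perron_pair_eq\<close> requires.\<close>
    then show "p = perron_pair m A"
      using limit perron_pair_eq[OF assms(1,2) that] by (cases p) metis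
  qed
  then show ?thesis using limit by blast
qed

end
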